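(* Let $p(z)=a_0z^n+a_1z^{n-1}+\dots+a_n$ be a real polynomial of degree $n\geqslant 1$ with $a_0>0$. The following conditions are equivalent: 1) $p$ is self-interlacing of type I; 2) the Hurwitz determinants $\Delta_j(p)$ satisfy $$\Delta_{n-1}(p)>0,\ \Delta_{n-3}(p)>0,\ \ldots,$$ $$(-1)^{\left[\frac{n+1}2\right]}\Delta_{n}(p)>0,\ (-1)^{\left[\frac{n+1}2\right]-1}\Delta_{n-2}(p)>0,\ \ldots;$$ 3) the determinants $\eta_j(p)$ up to order $n+1$ satisfy $$\eta_{n}(p)>0,\ \eta_{n-2}(p)>0,\ \ldots,\qquad \eta_1(p)=a_0>0,$$ $$(-1)^{\left[\frac{n+1}2\right]}\eta_{n+1}(p)>0,\ (-1)^{\left[\frac{n+1}2\right]-1}\eta_{n-1}(p)>0,\ \ldots$$ Each list runs over all indices $\geqslant 1$ of the indicated parity, the exponent of $-1$ decreasing by $1$ at each step in the lists that carry a sign.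
   Context: A real polynomial $p$ of degree $n$ is self-interlacing of type I if all its zeroes $\lambda_1,\dots,\lambda_n$ are real and simple and, suitably numbered, satisfy $0<\lambda_1<-\lambda_2<\lambda_3<\dots<(-1)^{n-1}\lambda_n$. Put $a_i=0$ for $i<0$ and $i>n$. The Hurwitz determinant $\Delta_j(p)$ ($1\leqslant j\leqslant n$) is the determinant of the $j\times j$ matrix whose $(r,s)$ entry is $a_{2s-r}$, i.e. with first rows $(a_1,a_3,a_5,\dots)$, $(a_0,a_2,a_4,\dots)$, $(0,a_1,a_3,\dots)$, $(0,a_0,a_2,\dots)$, etc. The determinant $\eta_j(p)$ is the leading principal minor of order $j$ of the infinite matrix whose $(r,s)$ entry is $a_{2s-r-1}$ ($r,s\geqslant1$), i.e. with rows $(a_0,a_2,a_4,\dots)$, $(0,a_1,a_3,\dots)$, $(0,a_0,a_2,\dots)$, $(0,0,a_1,\dots)$, etc. $[\rho]$ denotes the largest integer not exceeding $\rho$. *)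

theory Defs
  imports "Jordan_Normal_Form.Determinant" "HOL-Computational_Algebra.Polynomial"
begin

(* For p of degree n, desc_coeff p i is the coefficient a_i in
   p(z) = a_0 z^n + a_1 z^(n-1) + ... + a_n; the index is an integer because the
   matrices below refer to a_i with i < 0, where a_i = 0. *)
definition desc_coeff :: "real poly \<Rightarrow> int \<Rightarrow> real" where
  "desc_coeff p i =
     (if 0 \<le> i \<and> i \<le> int (degree p) then Polynomial.coeff p (degree p - nat i) else 0)"

definition self_interlacing_I :: "real poly \<Rightarrow> bool" where
  "self_interlacing_I p \<longleftrightarrow>
     (\<forall>z::complex. poly (map_poly complex_of_real p) z = 0 \<longrightarrow>
        z \<in> \<real> \<and> Polynomial.order z (map_poly complex_of_real p) = 1) \<and>
     (\<exists>l :: nat \<Rightarrow> real.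
        bij_betw l {1..degree p} {x. poly p x = 0} \<and>
        0 < l 1 \<and>
        (\<forall>i\<in>{1..<degree p}. (-1) ^ (i - 1) * l i < (-1) ^ i * l (i + 1)))"

(* Matrix positions count from 0, so position (r, s) holds the entry with 1-based
   indices (r + 1, s + 1): a_(2(s+1) - (r+1)) here and a_(2(s+1) - (r+1) - 1) in eta_minor. *)
definition hurwitz_det :: "real poly \<Rightarrow> nat \<Rightarrow> real" where
  "hurwitz_det p j =
     det (mat j j (\<lambda>(r, s). desc_coeff p (2 * (int s + 1) - (int r + 1))))"

definition eta_minor :: "real poly \<Rightarrow> nat \<Rightarrow> real" where
  "eta_minor p j =
     det (mat j j (\<lambda>(r, s). desc_coeff p (2 * (int s + 1) - (int r + 1) - 1)))"

end

theory Submission imports Defs begin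

text \<open>
  Write \<open>\<sigma> = (-1)^n\<close>. Split \<open>p\<close> into the terms of the same parity as its degree, \<open>f\<close>, and the
  remaining terms, \<open>\<sigma> g\<close>. Then \<open>p(x) = f(x) + \<sigma> g(x)\<close> and \<open>\<sigma> p(-x) = f(x) - \<sigma> g(x)\<close>, so a
  root \<open>\<lambda>\<close> of \<open>p\<close> is a point \<open>\<bar>\<lambda>\<bar>\<close> of the positive axis where \<open>f = g\<close> or \<open>f = - g\<close>, and the
  sign of \<open>\<lambda>\<close> tells which. Self-interlacing of type I means that the largest such point solves
  \<open>f = g\<close>, the next one \<open>f = - g\<close>, and so on alternately. Between two neighbouring points either
  \<open>f\<close> or \<open>g\<close> changes sign, and conversely zeros of \<open>f\<close> and \<open>g\<close> that alternate force \<open>f - g\<close> and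
  \<open>f + g\<close> to vanish alternately in between. Hence \<open>p\<close> is self-interlacing if and only if \<open>g\<close> has
  positive leading coefficient and the nonnegative zeros of \<open>f\<close> and \<open>g\<close> alternate, from a zero
  of \<open>f\<close> down to the zero at the origin that one of them has by parity
  (\<open>alternating_roots_imp_interlaced\<close>, \<open>interlaced_imp_alternating_roots\<close>).

  Such a pair is a Sturm pair: for the division \<open>f = c x g - h\<close>, the pair \<open>(f, g)\<close> is interlaced
  if and only if \<open>g\<close> has positive leading coefficient and \<open>(g, h)\<close> is interlaced, because \<open>f\<close> and
  \<open>- h\<close> agree at the zeros of \<open>g\<close> (\<open>interlaced_step_forward\<close>, \<open>interlaced_step_backward\<close>).

  The pair \<open>(g, h)\<close> consists of the two parts of a polynomial of degree \<open>n - 1\<close>, the Routh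
  reduct. The row operations that perform the division on the Hurwitz matrix show that
  \<open>\<Delta>\<^sub>j\<^sub>+\<^sub>1(p)\<close> is, up to a sign, \<open>\<Delta>\<^sub>j\<close> of the reduct times the leading coefficient of \<open>g\<close>
  (\<open>hurwitz_det_routh_step\<close>), and the signs work out so that the list of inequalities for \<open>p\<close> is
  the list for the reduct together with positivity of that leading coefficient. Induction on
  the degree yields the equivalence of the first two conditions
  (\<open>hurwitz_signs_iff_interlaced\<close>). The third condition is the second one in disguise, since
  \<open>\<eta>\<^sub>j\<^sub>+\<^sub>1(p) = a\<^sub>0 \<Delta>\<^sub>j(p)\<close>.
\<close>

section \<open>Hurwitz determinants under a Routh step\<close>

text \<open>
  Below its first entry \<open>a\<^sub>0\<close> the first column vanishes, and deleting the first row and column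
  leaves the Hurwitz matrix.
\<close>

lemma eta_minor_Suc:
  "eta_minor p (Suc j) = desc_coeff p 0 * hurwitz_det p j"
proof -
  define M where "M = mat (Suc j) (Suc j)
    (\<lambda>(r, s). desc_coeff p (2 * (int s + 1) - (int r + 1) - 1))"
  have M: "M \<in> carrier_mat (Suc j) (Suc j)"
    by (simp add: M_def)
  have column: "M $$ (r, 0) = 0" if "0 < r" "r < Suc j" for r
    using that by (simp add: M_def desc_coeff_def)
  have del: "mat_delete M 0 0 = mat j j (\<lambda>(r, s). desc_coeff p (2 * (int s + 1) - (int r + 1)))"
    by (rule eq_matI) (auto simp: mat_delete_def M_def algebra_simps)
  have "det M = (\<Sum>r<Suc j. M $$ (r, 0) * cofactor M r 0)"
    by (rule laplace_expansion_column[OF M]) simp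
  also have "\<dots> = M $$ (0, 0) * cofactor M 0 0"
    by (subst sum.remove[of _ 0]) (auto simp: column intro!: sum.neutral)
  also have "\<dots> = desc_coeff p 0 * hurwitz_det p j"
    by (simp add: cofactor_def del hurwitz_det_def) (simp add: M_def)
  finally show ?thesis
    by (simp add: eta_minor_def M_def)
qed

text \<open>
  The hypothesis describes the coefficients of the polynomial \<open>q\<close> obtained from \<open>p\<close> by one
  division step, scaled by \<open>e\<close>. On the Hurwitz matrix of \<open>p\<close> this step subtracts \<open>c\<close> times the
  preceding row from every row \<open>(a\<^sub>0, a\<^sub>2, \<dots>)\<close>, which is multiplication by a unitriangular
  matrix; the result is the matrix of \<open>\<eta>\<^sub>j(q)\<close>, not of \<open>\<Delta>\<^sub>j(q)\<close>, because all indices move by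
  one.
\<close>

lemma eta_minor_eq_hurwitz_det:
  assumes b: "\<And>i. desc_coeff q i =
    e * (desc_coeff p (i + 1) - (if odd i then c * desc_coeff p (i + 2) else 0))"
  shows "eta_minor q j = e ^ j * hurwitz_det p j"
proof -
  define H where "H = mat j j (\<lambda>(r, s). desc_coeff p (2 * (int s + 1) - (int r + 1)))"
  define L where "L = mat j j (\<lambda>(r, k).
    if k = r then 1 else if odd r \<and> r = Suc k then - c else (0::real))"
  have H: "H \<in> carrier_mat j j" and L: "L \<in> carrier_mat j j"
    by (simp_all add: H_def L_def)
  have LH: "(L * H) $$ (r, s) =
      desc_coeff p (2 * int s - int r + 1) - (if odd r then c * desc_coeff p (2 * int s - int r + 2) else 0)"
    if rs: "r < j" "s < j" for r s
  proof -
    have "(L * H) $$ (r, s) = (\<Sum>k<j. L $$ (r, k) * H $$ (k, s))"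
      using rs H L by (auto simp: scalar_prod_def atLeast0LessThan intro!: sum.cong)
    also have "\<dots> = (\<Sum>k<j. (if k = r then H $$ (k, s) else 0) +
        (if odd r then (if k = r - 1 then - c * H $$ (k, s) else 0) else 0))"
      using rs by (intro sum.cong) (auto simp: L_def)
    also have "\<dots> = H $$ (r, s) + (if odd r then - c * H $$ (r - 1, s) else 0)"
      using rs by (auto simp: sum.distrib)
    also have "\<dots> = desc_coeff p (2 * int s - int r + 1) -
        (if odd r then c * desc_coeff p (2 * int s - int r + 2) else 0)"
      using rs odd_pos[of r] by (auto simp: H_def of_nat_diff algebra_simps)
    finally show ?thesis .
  qed
  have "det L = 1"
  proof -
    have "det L = prod_list (diag_mat L)"
      by (rule det_lower_triangular[OF _ L]) (auto simp: L_def)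
    also have "diag_mat L = map (\<lambda>_. 1) [0..<j]"
      by (simp add: diag_mat_def L_def)
    finally show ?thesis
      by (simp add: map_replicate_const prod_list_replicate)
  qed
  have "mat j j (\<lambda>(r, s). desc_coeff q (2 * (int s + 1) - (int r + 1) - 1)) = e \<cdot>\<^sub>m (L * H)"
    (is "?M = _")
  proof (rule eq_matI)
    fix r s assume "r < dim_row (e \<cdot>\<^sub>m (L * H))" "s < dim_col (e \<cdot>\<^sub>m (L * H))"
    then have rs: "r < j" "s < j"
      using H L by auto
    have "?M $$ (r, s) = desc_coeff q (2 * int s - int r)"
      using rs by (simp add: algebra_simps)
    also have "\<dots> = e * (L * H) $$ (r, s)"
      unfolding LH[OF rs] b by simp
    finally show "?M $$ (r, s) = (e \<cdot>\<^sub>m (L * H)) $$ (r, s)"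
      using rs H L by simp
  qed (use H L in auto)
  then have "eta_minor q j = e ^ j * (det L * det H)"
    using H L det_mult[OF L H] by (simp add: eta_minor_def)
  then show ?thesis
    by (simp add: \<open>det L = 1\<close> hurwitz_det_def H_def)
qed

text \<open>
  The terms of \<open>p\<close> whose exponent has the parity of the degree, and \<open>(-1)^n\<close> times the other
  terms. With this sign both parts of a self-interlacing polynomial with positive leading
  coefficient have positive leading coefficients.
\<close>

definition main_part :: "real poly \<Rightarrow> real poly" where
  "main_part p = smult (1/2) (p + smult ((-1) ^ degree p) (pcompose p [:0, -1:]))"

definition lower_part :: "real poly \<Rightarrow> real poly" where
  "lower_part p = smult (1/2) (smult ((-1) ^ degree p) p - pcompose p [:0, -1:])"

lemma poly_main_part:
  "poly (main_part p) x = (poly p x + (-1) ^ degree p * poly p (- x)) / 2"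
  by (simp add: main_part_def poly_pcompose)

lemma poly_lower_part:
  "poly (lower_part p) x = ((-1) ^ degree p * poly p x - poly p (- x)) / 2"
  by (simp add: lower_part_def poly_pcompose)

lemma coeff_main_part:
  "Polynomial.coeff (main_part p) k = (if even (degree p + k) then Polynomial.coeff p k else 0)"
  by (auto simp: main_part_def coeff_pcompose_linear minus_one_power_iff)

lemma coeff_lower_part:
  "Polynomial.coeff (lower_part p) k =
    (if odd (degree p + k) then (-1) ^ degree p * Polynomial.coeff p k else 0)"
  by (auto simp: lower_part_def coeff_pcompose_linear minus_one_power_iff)

definition lower_lc :: "real poly \<Rightarrow> real" where
  "lower_lc p = Polynomial.coeff (lower_part p) (degree p - 1)"

text \<open>
  The factor removes the leading term of the main part, so this is the negative of a division
  remainder. With this sign the remainder of an interlaced pair of degree at least two has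
  positive leading coefficient again.
\<close>

definition routh_remainder :: "real poly \<Rightarrow> real poly" where
  "routh_remainder p = smult (lead_coeff p / lower_lc p) (pCons 0 (lower_part p)) - main_part p"

text \<open>
  The polynomial of degree one less whose parts are \<open>lower_part p\<close> and \<open>routh_remainder p\<close>; the
  sign anticipates that its degree has the other parity.
\<close>

definition routh_reduct :: "real poly \<Rightarrow> real poly" where
  "routh_reduct p = lower_part p - smult ((-1) ^ degree p) (routh_remainder p)"

lemma lower_lc_eq:
  "1 \<le> degree p \<Longrightarrow> lower_lc p = (-1) ^ degree p * Polynomial.coeff p (degree p - 1)"
  by (auto simp: lower_lc_def coeff_lower_part)

text \<open>
  Up to the overall sign, the division changes only the coefficients at exponents with the
  parity of the degree.
\<close>

lemma coeff_routh_reduct: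
  assumes "1 \<le> degree p"
  shows "Polynomial.coeff (routh_reduct p) k = (-1) ^ degree p * (Polynomial.coeff p k -
    (if even (degree p + k) \<and> 0 < k
     then lead_coeff p / Polynomial.coeff p (degree p - 1) * Polynomial.coeff p (k - 1) else 0))"
  using assms by (auto simp: routh_reduct_def routh_remainder_def coeff_lower_part coeff_main_part
      lower_lc_eq coeff_pCons minus_one_power_iff split: nat.splits)

lemma degree_routh_reduct:
  assumes n: "1 \<le> degree p" and a1: "lower_lc p \<noteq> 0"
  shows "degree (routh_reduct p) = degree p - 1"
    and "lead_coeff (routh_reduct p) = lower_lc p"
proof -
  have a1': "Polynomial.coeff p (degree p - 1) \<noteq> 0"
    using a1 n by (simp add: lower_lc_eq)
  have "Polynomial.coeff (routh_reduct p) k = 0" if "k > degree p - 1" for k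
  proof (cases "k = degree p")
    case True
    then show ?thesis using n a1' by (simp add: coeff_routh_reduct)
  next
    case False
    then have "degree p < k" "degree p < k - 1 \<or> odd (degree p + k)"
      using that n by (cases "k = Suc (degree p)"; simp; linarith)+
    then show ?thesis using n by (auto simp: coeff_routh_reduct coeff_eq_0)
  qed
  then have le: "degree (routh_reduct p) \<le> degree p - 1"
    by (meson degree_le)
  have top: "Polynomial.coeff (routh_reduct p) (degree p - 1) = lower_lc p"
    using n by (auto simp: coeff_routh_reduct lower_lc_eq)
  then have "degree p - 1 \<le> degree (routh_reduct p)"
    using a1 by (intro le_degree) simp
  with le show "degree (routh_reduct p) = degree p - 1" by simp
  then show "lead_coeff (routh_reduct p) = lower_lc p"
    using top by simp
qed

lemma desc_coeff_routh_reduct: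
  assumes n: "1 \<le> degree p" and a1: "lower_lc p \<noteq> 0"
  shows "desc_coeff (routh_reduct p) i = (-1) ^ degree p * (desc_coeff p (i + 1) -
    (if odd i then lead_coeff p / Polynomial.coeff p (degree p - 1) * desc_coeff p (i + 2) else 0))"
proof -
  define n where "n = degree p"
  have n1: "1 \<le> n" and a1': "Polynomial.coeff p (n - 1) \<noteq> 0"
    using a1 n by (simp_all add: lower_lc_eq n_def)
  consider "i < - 1" | "i = - 1" | "0 \<le> i" "i \<le> int n - 1" | "i > int n - 1"
    by linarith
  then show ?thesis
  proof cases
    case 1
    then have "i + 2 < 0" if "odd i"
      using that by (cases "i = -2") auto
    then show ?thesis using 1 by (auto simp: desc_coeff_def)
  next
    case 2
    then show ?thesis using a1' n1 by (simp add: desc_coeff_def n_def)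
  next
    case 3
    define k where "k = n - 1 - nat i"
    have i: "i = int (n - 1 - k)" and kn: "k < n"
      using 3 by (auto simp: k_def)
    have "desc_coeff (routh_reduct p) i = Polynomial.coeff (routh_reduct p) k"
      using 3 n1 degree_routh_reduct(1)[OF n a1] by (auto simp: desc_coeff_def k_def n_def)
    moreover have "desc_coeff p (i + 1) = Polynomial.coeff p k"
    proof -
      have "n - nat (i + 1) = k" "0 \<le> i + 1" "i + 1 \<le> int n" using kn by (auto simp: i)
      then show ?thesis by (simp add: desc_coeff_def n_def)
    qed
    moreover have "desc_coeff p (i + 2) = (if k = 0 then 0 else Polynomial.coeff p (k - 1))"
    proof -
      have "n - nat (i + 2) = k - 1" "0 \<le> i + 2" "i + 2 \<le> int n \<longleftrightarrow> 0 < k"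
        using kn by (auto simp: i)
      then show ?thesis by (simp add: desc_coeff_def n_def)
    qed
    moreover have "odd i \<longleftrightarrow> even (n + k)"
      using kn by (auto simp: i)
    ultimately show ?thesis
      by (simp add: coeff_routh_reduct[OF n] n_def)
  next
    case 4
    then show ?thesis
      using n1 degree_routh_reduct(1)[OF n a1] by (auto simp: desc_coeff_def n_def)
  qed
qed

text \<open>
  The factor \<open>lower_lc p\<close> is the entry \<open>a\<^sub>0\<close> of the reduct that is split off the first column of
  the matrix of \<open>\<eta>\<close>; the sign comes from the scaling of all rows by \<open>(-1)^n\<close>.
\<close>

lemma hurwitz_det_routh_step:
  assumes n: "1 \<le> degree p" and a1: "lower_lc p \<noteq> 0"
  shows "hurwitz_det p (Suc j) =
    ((-1) ^ degree p) ^ Suc j * lower_lc p * hurwitz_det (routh_reduct p) j"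
proof -
  let ?e = "((-1) ^ degree p) ^ Suc j :: real"
  have "eta_minor (routh_reduct p) (Suc j) = ?e * hurwitz_det p (Suc j)"
    by (rule eta_minor_eq_hurwitz_det[OF desc_coeff_routh_reduct[OF n a1]])
  moreover have "desc_coeff (routh_reduct p) 0 = lower_lc p"
    using degree_routh_reduct[OF n a1] by (simp add: desc_coeff_def)
  ultimately have "?e * hurwitz_det p (Suc j) = lower_lc p * hurwitz_det (routh_reduct p) j"
    by (simp add: eta_minor_Suc)
  then have "?e * ?e * hurwitz_det p (Suc j) = ?e * lower_lc p * hurwitz_det (routh_reduct p) j"
    by (simp add: mult.assoc)
  moreover have "?e * ?e = 1"
    unfolding power_mult_distrib[symmetric] by simp
  ultimately show ?thesis
    by (simp only: mult_1)
qed

text \<open>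
  The sign required of \<open>\<Delta>\<^sub>j\<close>. For \<open>j = n - 2 k\<close> the exponent \<open>[(n + 1) / 2] - k\<close> equals
  \<open>[(j + 1) / 2]\<close>, so it can be written without \<open>k\<close>.
\<close>

definition hurwitz_sign :: "nat \<Rightarrow> nat \<Rightarrow> real" where
  "hurwitz_sign n j = (if even (n - j) then (-1) ^ ((j + 1) div 2) else 1)"

definition hurwitz_signs :: "real poly \<Rightarrow> bool" where
  "hurwitz_signs p \<longleftrightarrow>
    (\<forall>j. 1 \<le> j \<and> j \<le> degree p \<longrightarrow> 0 < hurwitz_sign (degree p) j * hurwitz_det p j)"

text \<open>
  The sign pattern is invariant under a Routh step: the left-hand side is the sign required of
  \<open>\<Delta>\<^sub>j\<^sub>+\<^sub>1(p)\<close>, corrected by the sign that relates it to \<open>\<Delta>\<^sub>j\<close> of the reduct.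
\<close>

lemma hurwitz_sign_Suc:
  assumes "j < n"
  shows "hurwitz_sign n (Suc j) * ((-1) ^ n) ^ Suc j = hurwitz_sign (n - 1) j"
proof (cases "even (n - 1 - j)")
  case True
  then have "even (n - Suc j)" and n: "even n \<longleftrightarrow> odd j"
    using assms by auto
  then have "hurwitz_sign n (Suc j) = (-1) ^ ((j + 2) div 2)"
    "hurwitz_sign (n - 1) j = (-1) ^ ((j + 1) div 2)"
    using True by (auto simp: hurwitz_sign_def)
  moreover obtain m where "j = 2 * m \<or> j = 2 * m + 1"
    by (metis oddE evenE)
  ultimately show ?thesis
    using n by (auto simp: uminus_power_if)
next
  case False
  then have "odd (n - Suc j)" and n: "even n \<longleftrightarrow> even j"
    using assms by auto
  then show ?thesis
    using False by (cases "even n") (auto simp: hurwitz_sign_def)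
qed

lemma hurwitz_det_1: "1 \<le> degree p \<Longrightarrow> hurwitz_det p 1 = (-1) ^ degree p * lower_lc p"
  by (simp add: hurwitz_det_def lower_lc_eq det_single desc_coeff_def)

lemma hurwitz_sign_1: "1 \<le> n \<Longrightarrow> hurwitz_sign n 1 = (-1) ^ n"
  by (auto simp: hurwitz_sign_def minus_one_power_iff)

lemma hurwitz_signs_imp_lower_lc_pos:
  assumes "hurwitz_signs p" "1 \<le> degree p"
  shows "0 < lower_lc p"
  using assms unfolding hurwitz_signs_def
  by (auto dest!: spec[of _ 1] simp: hurwitz_det_1[simplified] hurwitz_sign_1[simplified])

lemma hurwitz_signs_routh_reduct:
  assumes n: "1 \<le> degree p" and a1: "0 < lower_lc p"
  shows "hurwitz_signs p \<longleftrightarrow> hurwitz_signs (routh_reduct p)"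
proof -
  have step: "0 < hurwitz_sign (degree p) (Suc j) * hurwitz_det p (Suc j) \<longleftrightarrow>
      0 < hurwitz_sign (degree p - 1) j * hurwitz_det (routh_reduct p) j" if "j < degree p" for j
  proof -
    have "hurwitz_sign (degree p) (Suc j) * hurwitz_det p (Suc j) =
        (hurwitz_sign (degree p) (Suc j) * ((-1) ^ degree p) ^ Suc j) *
        hurwitz_det (routh_reduct p) j * lower_lc p"
      using hurwitz_det_routh_step[of p j] n a1 by simp
    then show ?thesis
      using a1 unfolding hurwitz_sign_Suc[OF that] by (simp add: zero_less_mult_iff)
  qed
  \<comment> \<open>The shift of the index sends \<open>\<Delta>\<^sub>1(p)\<close> to the empty determinant.\<close>
  have 0: "0 < hurwitz_sign (degree p - 1) 0 * hurwitz_det (routh_reduct p) 0"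
    by (simp add: hurwitz_sign_def hurwitz_det_def)
  have deg: "degree (routh_reduct p) = degree p - 1"
    using degree_routh_reduct(1)[OF n] a1 by simp
  have "hurwitz_signs p \<longleftrightarrow>
      (\<forall>j<degree p. 0 < hurwitz_sign (degree p) (Suc j) * hurwitz_det p (Suc j))"
    unfolding hurwitz_signs_def
    by (metis Suc_le_D Suc_le_eq Suc_le_mono One_nat_def le0)
  also have "\<dots> \<longleftrightarrow>
      (\<forall>j<degree p. 0 < hurwitz_sign (degree p - 1) j * hurwitz_det (routh_reduct p) j)"
    using step by blast
  also have "\<dots> \<longleftrightarrow> hurwitz_signs (routh_reduct p)" (is "?P \<longleftrightarrow> ?Q")
  proof
    show ?Q if ?P
      using that n by (auto simp: hurwitz_signs_def deg)
    show ?P if ?Q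
    proof (intro allI impI)
      fix j assume "j < degree p"
      with \<open>?Q\<close> 0 show "0 < hurwitz_sign (degree p - 1) j * hurwitz_det (routh_reduct p) j"
        by (cases "j = 0") (auto simp: hurwitz_signs_def deg)
    qed
  qed
  finally show ?thesis .
qed

section \<open>Interlaced pairs\<close>

lemma minus_one_power_cases: "(-1::real) ^ k = 1 \<or> (-1::real) ^ k = - 1"
  by (simp add: minus_one_power_iff)

lemma decreasing_from_Suc:
  fixes s :: "nat \<Rightarrow> real"
  assumes "\<And>j. Suc j < n \<Longrightarrow> s (Suc j) < s j" "i < j" "j < n"
  shows "s j < s i"
  using assms(2,3)
proof (induction j)
  case (Suc j)
  then show ?case
    using assms(1)[of j] by (cases "i = j") auto
qed simp

lemma decreasing_from_Suc_le:
  fixes s :: "nat \<Rightarrow> real"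
  assumes "\<And>j. Suc j < n \<Longrightarrow> s (Suc j) < s j" "i \<le> j" "j < n"
  shows "s j \<le> s i"
  using decreasing_from_Suc[of n s i j] assms by (cases "i = j") auto

lemma poly_same_sign:
  fixes g :: "real poly"
  assumes "\<And>z. min x y \<le> z \<Longrightarrow> z \<le> max x y \<Longrightarrow> poly g z \<noteq> 0"
  shows "0 < poly g x * poly g y"
proof (rule ccontr)
  assume neg: "\<not> 0 < poly g x * poly g y"
  have "poly g x \<noteq> 0" "poly g y \<noteq> 0"
    using assms by auto
  with neg have neg: "poly g x * poly g y < 0" and "x \<noteq> y"
    by (auto simp: less_le)
  then consider "x < y" | "y < x" by linarith
  then show False
    using poly_IVT[of x y g] poly_IVT[of y x g] neg assms
    by cases (force simp: mult.commute)+
qed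

text \<open>
  Each positive root comes with its negative, so it counts twice.
\<close>

lemma symmetric_roots_bound:
  fixes g :: "real poly"
  assumes g: "g \<noteq> 0" and sym: "\<And>x. poly g x = 0 \<Longrightarrow> poly g (- x) = 0"
    and P: "finite P" "\<And>x. x \<in> P \<Longrightarrow> 0 < x \<and> poly g x = 0"
  shows "2 * card P + (if poly g 0 = 0 then 1 else 0) \<le> degree g"
proof -
  let ?Z = "if poly g 0 = 0 then {0} else {}"
  have pos: "0 < x" if "x \<in> P" for x
    using P(2)[OF that] by simp
  have "P \<inter> uminus ` P = {}"
  proof (rule equals0I)
    fix x assume "x \<in> P \<inter> uminus ` P"
    then obtain y where "x \<in> P" "y \<in> P" "x = - y" by blast
    then show False using pos[of x] pos[of y] by simp
  qed
  moreover have "(P \<union> uminus ` P) \<inter> ?Z = {}"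
    using pos[of 0] by (auto split: if_splits)
  ultimately have "card (P \<union> uminus ` P \<union> ?Z) = 2 * card P + (if poly g 0 = 0 then 1 else 0)"
    using P(1) by (subst card_Un_disjoint) (auto simp: card_Un_disjoint card_image)
  moreover have "P \<union> uminus ` P \<union> ?Z \<subseteq> {x. poly g x = 0}"
    using P(2) sym by auto
  then have "card (P \<union> uminus ` P \<union> ?Z) \<le> card {x. poly g x = 0}"
    by (rule card_mono[OF poly_roots_finite[OF g]])
  then have "card (P \<union> uminus ` P \<union> ?Z) \<le> degree g"
    using card_poly_roots_bound[OF g] by (rule le_trans)
  ultimately show ?thesis
    by (simp only:)
qed

lemma card_even_less: "card {k::nat. even k \<and> Suc k < m} = m div 2"
proof -
  have "{k::nat. even k \<and> Suc k < m} = (\<lambda>i. 2 * i) ` {..<m div 2}"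
    by (auto elim!: evenE)
  then show ?thesis
    by (simp add: card_image inj_on_def)
qed

text \<open>
  A polynomial with symmetric roots that vanishes at every other knot of a sequence descending
  to \<open>0\<close>. In an interlaced pair, \<open>g\<close> is of this kind once the largest knot is dropped.
\<close>

context
  fixes g :: "real poly" and m :: nat and t :: "nat \<Rightarrow> real"
  assumes g: "g \<noteq> 0" and sym: "\<And>x. poly g x = 0 \<Longrightarrow> poly g (- x) = 0"
    and m: "1 \<le> m"
    and dec: "\<And>j. Suc j < m \<Longrightarrow> t (Suc j) < t j" and end0: "t (m - 1) = 0"
    and zero: "\<And>k. k < m \<Longrightarrow> even k \<Longrightarrow> poly g (t k) = 0"
begin

text \<open>
  The knots of even index are \<open>m div 2\<close> positive numbers, and also \<open>0\<close> if \<open>m\<close> is odd; with their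
  negatives these are \<open>m\<close> roots. For degree \<open>m\<close> there is no room for another positive root, and
  so the sign of \<open>g\<close> is known on every interval between consecutive roots.
\<close>

lemma root_knots_count:
  assumes Y: "finite Y" "\<And>y. y \<in> Y \<Longrightarrow> 0 < y \<and> poly g y = 0 \<and> (\<forall>k<m. even k \<longrightarrow> y \<noteq> t k)"
  shows "m + 2 * card Y \<le> degree g"
proof -
  define K where "K = {k. even k \<and> Suc k < m}"
  have dec': "t j < t i" if "i < j" "j < m" for i j
    using decreasing_from_Suc[of m t i j, OF dec] that by blast
  have "finite K"
    by (rule finite_subset[of _ "{..<m}"]) (auto simp: K_def)
  have pos: "0 < t k" if "Suc k < m" for k
    using dec'[of k "m - 1"] end0 that by simp
  have inj: "inj_on t K"
  proof (rule inj_onI)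
    fix i j assume "i \<in> K" "j \<in> K" "t i = t j"
    then show "i = j"
      using dec'[of i j] dec'[of j i] by (cases i j rule: linorder_cases) (auto simp: K_def)
  qed
  have "Y \<inter> t ` K = {}"
    using Y(2) unfolding K_def by (blast dest: Suc_lessD)
  then have "card (Y \<union> t ` K) = card Y + m div 2"
    using \<open>finite K\<close> Y(1) card_even_less[of m, folded K_def]
    by (simp add: card_Un_disjoint card_image[OF inj])
  moreover have "2 * card (Y \<union> t ` K) + (if poly g 0 = 0 then 1 else 0) \<le> degree g"
    using \<open>finite K\<close> pos zero Y by (intro symmetric_roots_bound[OF g sym]) (auto simp: K_def)
  moreover have "poly g 0 = 0" if "odd m"
    using zero[of "m - 1"] end0 that m by simp
  ultimately show ?thesis
    by (cases "odd m") (auto elim!: evenE oddE)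
qed

lemma no_further_positive_root:
  assumes deg: "degree g \<le> m"
    and y: "0 < y" "poly g y = 0"
  shows "\<exists>k<m. even k \<and> y = t k"
proof (rule ccontr)
  assume "\<not> ?thesis"
  then have "m + 2 * card {y} \<le> degree g"
    using y by (intro root_knots_count) auto
  with deg show False by simp
qed

lemma nonneg_knots: "k < m \<Longrightarrow> 0 \<le> t k"
  using decreasing_from_Suc_le[of m t k "m - 1", OF dec] end0 m by simp

text \<open>
  The zeros of \<open>g\<close> that surround \<open>t k\<close> are the knots next to it.
\<close>

lemma same_sign_in_gap:
  assumes deg: "degree g \<le> m" and k: "odd k" "Suc k < m" and y: "t (Suc k) < y" "y < t (k - 1)"
  shows "0 < poly g y * poly g (t k)"
proof (rule poly_same_sign)
  fix z assume z: "min y (t k) \<le> z" "z \<le> max y (t k)"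
  have tk: "t (Suc k) < t k" "t k < t (k - 1)"
    using dec[of k] dec[of "k - 1"] k odd_pos[of k] by auto
  then have z': "t (Suc k) < z" "z < t (k - 1)"
    using z y by linarith+
  have "z \<noteq> t i" if "i < m" "even i" for i
  proof -
    have "i \<noteq> k" using \<open>odd k\<close> \<open>even i\<close> by auto
    then consider "i \<le> k - 1" | "Suc k \<le> i" by linarith
    then show ?thesis
    proof cases
      case 1
      then have "t (k - 1) \<le> t i"
        using decreasing_from_Suc_le[of m t i "k - 1", OF dec] k by simp
      then show ?thesis using z' by simp
    next
      case 2
      then have "t i \<le> t (Suc k)"
        using decreasing_from_Suc_le[of m t "Suc k" i, OF dec] that by simp
      then show ?thesis using z' by simp
    qed
  qed
  moreover have "0 < z"
    using z' nonneg_knots[of "Suc k"] k by simp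
  ultimately show "poly g z \<noteq> 0"
    using no_further_positive_root[OF deg] by blast
qed

text \<open>
  Beyond the largest root the sign is that of the values near infinity.
\<close>

lemma lead_sign_beyond:
  assumes deg: "degree g \<le> m" and y: "t 0 < y"
  shows "0 < lead_coeff g * poly g y"
proof -
  have nz: "poly g z \<noteq> 0" if z: "y \<le> z" for z
  proof
    assume "poly g z = 0"
    moreover have "0 < z" using y z nonneg_knots[of 0] m by simp
    ultimately obtain i where "i < m" "z = t i"
      using no_further_positive_root[OF deg] by blast
    moreover from this have "t i \<le> t 0"
      using decreasing_from_Suc_le[of m t 0 i, OF dec] by simp
    ultimately show False using y z by simp
  qed
  define G where "G = smult (sgn (lead_coeff g)) g"
  have "lead_coeff G > 0"
    using g leading_coeff_neq_0[of g] by (auto simp: G_def sgn_if not_less order_le_less)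
  then obtain b where b: "\<And>x. b \<le> x \<Longrightarrow> lead_coeff G \<le> poly G x"
    using poly_pinfty_gt_lc[of G] by blast
  have "0 < poly g y * poly g (max b y)"
    by (rule poly_same_sign) (simp add: nz)
  moreover have "0 < poly G (max b y)"
    using b[of "max b y"] \<open>lead_coeff G > 0\<close> by simp
  moreover have "lead_coeff g < 0 \<or> 0 < lead_coeff g"
    using g by (metis leading_coeff_neq_0 linorder_neqE_linordered_idom)
  ultimately show ?thesis
    by (auto simp: G_def sgn_if zero_less_mult_iff mult_less_0_iff split: if_splits)
qed

end

text \<open>
  The points \<open>s 0 > s 1 > \<dots> > s (n - 1) = 0\<close> are alternately zeros of \<open>f\<close> and of \<open>g\<close>, starting
  with \<open>f\<close>, and the signs at these points are those forced on \<open>f\<close> and \<open>g\<close> by simple zeros there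
  and positive leading coefficients. Counting from the largest point makes the pattern
  independent of \<open>n\<close>. Recording the signs rather than the absence of further zeros turns most
  existence arguments into applications of the intermediate value theorem.
\<close>

definition interlaced :: "nat \<Rightarrow> real poly \<Rightarrow> real poly \<Rightarrow> bool" where
  "interlaced n f g \<longleftrightarrow> (\<exists>s :: nat \<Rightarrow> real.
     (\<forall>j. Suc j < n \<longrightarrow> s (Suc j) < s j) \<and> s (n - 1) = 0 \<and>
     (\<forall>j<n. if even j then poly f (s j) = 0 \<and> 0 < (-1) ^ (j div 2) * poly g (s j)
            else poly g (s j) = 0 \<and> (-1) ^ (j div 2) * poly f (s j) < 0))"

lemma interlaced_1:
  assumes "poly f 0 = 0"
  shows "interlaced 1 f g \<longleftrightarrow> 0 < poly g 0"
  using assms by (auto simp: interlaced_def intro!: exI[of _ "\<lambda>_. 0"])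

text \<open>
  At the zeros of \<open>g\<close> the value of \<open>h\<close> is \<open>- f\<close>, so \<open>h\<close> changes sign between any two consecutive
  ones. The knots for \<open>(g, h)\<close> are the zeros \<open>s 1, s 3, \<dots>\<close> of \<open>g\<close>, interspersed with zeros of
  \<open>h\<close> obtained in this way; if \<open>n\<close> is odd, the last of these is \<open>0\<close>, a zero of \<open>h\<close> by parity.
\<close>

lemma interlaced_step_forward:
  assumes n: "2 \<le> n"
    and fpar: "\<And>x. poly f (- x) = (-1) ^ n * poly f x"
    and gpar: "\<And>x. poly g (- x) = - ((-1) ^ n) * poly g x"
    and deg: "degree g \<le> n - 1"
    and h: "\<And>x. poly h x = c * x * poly g x - poly f x"
    and il: "interlaced n f g"
  shows "0 < Polynomial.coeff g (n - 1)" "interlaced (n - 1) g h"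
proof -
  obtain s :: "nat \<Rightarrow> real" where dec: "\<And>j. Suc j < n \<Longrightarrow> s (Suc j) < s j"
    and end0: "s (n - 1) = 0"
    and even_s: "\<And>j. j < n \<Longrightarrow> even j \<Longrightarrow> poly f (s j) = 0 \<and> 0 < (-1) ^ (j div 2) * poly g (s j)"
    and odd_s: "\<And>j. j < n \<Longrightarrow> odd j \<Longrightarrow> poly g (s j) = 0 \<and> (-1) ^ (j div 2) * poly f (s j) < 0"
    using il unfolding interlaced_def by (metis (full_types))
  \<comment> \<open>Without the largest knot, the zeros of \<open>g\<close> are the knots of even index.\<close>
  define t where "t k = s (Suc k)" for k
  have g0: "g \<noteq> 0"
    using even_s[of 0] n by auto
  have sym: "poly g (- x) = 0" if "poly g x = 0" for x
    using gpar[of x] that by simp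
  have m: "1 \<le> n - 1" and last: "Suc (n - 1 - 1) = n - 1"
    using n by simp_all
  have dect: "t (Suc j) < t j" if "Suc j < n - 1" for j
    using dec[of "Suc j"] that by (simp add: t_def)
  have endt: "t (n - 1 - 1) = 0"
    using end0 last by (simp add: t_def)
  have zerot: "poly g (t k) = 0" if "k < n - 1" "even k" for k
    using odd_s[of "Suc k"] that by (simp add: t_def)
  note gap = same_sign_in_gap[OF g0 sym m dect endt zerot deg]
  have "0 < lead_coeff g * poly g (s 0)"
    using lead_sign_beyond[OF g0 sym m dect endt zerot deg, of "s 0"] dec[of 0] n by (simp add: t_def)
  moreover have "0 < poly g (s 0)"
    using even_s[of 0] n by simp
  ultimately have lead: "0 < lead_coeff g"
    by (simp add: zero_less_mult_iff)
  have hval: "poly h x = - poly f x" if "poly g x = 0" for x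
    using that by (simp add: h)
  have "\<exists>y. (if even k then y = s (Suc k)
        else (if Suc k = n - 1 then y = 0 else s (Suc (Suc k)) < y \<and> y < s k) \<and>
          poly h y = 0 \<and> 0 < poly g y * poly g (s (Suc k)))" if k: "k < n - 1" for k
  proof (cases "even k")
    case False
    have "Suc k < n" using k by simp
    then have "poly g (s (Suc k)) \<noteq> 0"
      using even_s[of "Suc k"] False by auto
    then have gg: "0 < poly g (s (Suc k)) * poly g (s (Suc k))"
      by (auto simp: zero_less_mult_iff)
    show ?thesis
    proof (cases "Suc k = n - 1")
      case True
      then have "n = Suc (Suc k)" using n by linarith
      then have "odd n" using False by simp
      then have "poly f 0 = 0" using fpar[of 0] by simp
      then show ?thesis
        using True False end0 gg
        by (auto simp: h)
    next
      case neq: False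
      then have k2: "Suc (Suc k) < n" using k by simp
      have "poly h (s (Suc (Suc k))) * poly h (s k) = poly f (s (Suc (Suc k))) * poly f (s k)"
        using odd_s[of k] odd_s[of "Suc (Suc k)"] False k2 by (simp add: hval)
      also have "\<dots> < 0"
        using odd_s[of k] odd_s[of "Suc (Suc k)"] False k2 minus_one_power_cases[of "k div 2"]
        by (auto simp: mult_less_0_iff)
      finally obtain y where y: "s (Suc (Suc k)) < y" "y < s k" "poly h y = 0"
        using poly_IVT[of "s (Suc (Suc k))" "s k" h] dec[of k] dec[of "Suc k"] k2 by auto
      have "0 < poly g y * poly g (s (Suc k))"
        using gap[of k y] y False k2 neq odd_pos[of k] by (simp add: t_def)
      then show ?thesis using y False neq by auto
    qed
  qed auto
  then obtain u where u: "\<And>k. k < n - 1 \<Longrightarrow> (if even k then u k = s (Suc k)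
        else (if Suc k = n - 1 then u k = 0 else s (Suc (Suc k)) < u k \<and> u k < s k) \<and>
          poly h (u k) = 0 \<and> 0 < poly g (u k) * poly g (s (Suc k)))"
    by metis
  show "0 < Polynomial.coeff g (n - 1)"
  proof -
    have "n - 1 + 2 * card ({} :: real set) \<le> degree g"
      by (rule root_knots_count[OF g0 sym m dect endt zerot]) auto
    then have "degree g = n - 1"
      using deg by simp
    then show ?thesis using lead by simp
  qed
  show "interlaced (n - 1) g h"
    unfolding interlaced_def
  proof (intro exI[of _ u] conjI allI impI)
    fix k assume k: "Suc k < n - 1"
    show "u (Suc k) < u k"
      using u[of k] u[of "Suc k"] k dec[of "Suc k"] end0
      by (cases "even k"; cases "Suc (Suc k) = n - 1") auto
  next
    show "u (n - 1 - 1) = 0"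
    proof -
      define k where "k = n - 2"
      have "n = Suc (Suc k)" using n by (simp add: k_def)
      then show ?thesis
        using u[of k] end0 by (auto split: if_splits)
    qed
  next
    fix k assume "k < n - 1"
    then have k: "k < n - 1" "Suc k < n" by simp_all
    show "if even k then poly g (u k) = 0 \<and> 0 < (- 1) ^ (k div 2) * poly h (u k)
         else poly h (u k) = 0 \<and> (- 1) ^ (k div 2) * poly g (u k) < 0"
    proof (cases "even k")
      case True
      then show ?thesis
        using u[of k] odd_s[of "Suc k"] k by (simp add: hval)
    next
      case False
      then show ?thesis
        using u[of k] even_s[of "Suc k"] k minus_one_power_cases[of "k div 2"]
        by (auto simp: zero_less_mult_iff)
    qed
  qed
qed

text \<open>
  Zeros of \<open>f\<close> between the zeros of \<open>g\<close> arise as zeros of \<open>h\<close> did in the opposite direction. The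
  knot \<open>s 0\<close> is new: at the largest zero of \<open>g\<close> the polynomial \<open>f\<close> is negative, and positive far
  out.
\<close>

lemma interlaced_step_backward:
  assumes n: "2 \<le> n"
    and fpar: "\<And>x. poly f (- x) = (-1) ^ n * poly f x"
    and gpar: "\<And>x. poly g (- x) = - ((-1) ^ n) * poly g x"
    and deg: "degree g = n - 1"
    and h: "\<And>x. poly h x = c * x * poly g x - poly f x"
    and lead: "0 < lead_coeff f" "0 < lead_coeff g"
    and il: "interlaced (n - 1) g h"
  shows "interlaced n f g"
proof -
  obtain t :: "nat \<Rightarrow> real" where dec: "\<And>j. Suc j < n - 1 \<Longrightarrow> t (Suc j) < t j"
    and end0: "t (n - 1 - 1) = 0"
    and even_t: "\<And>j. j < n - 1 \<Longrightarrow> even j \<Longrightarrow> poly g (t j) = 0 \<and> 0 < (-1) ^ (j div 2) * poly h (t j)"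
    and odd_t: "\<And>j. j < n - 1 \<Longrightarrow> odd j \<Longrightarrow> poly h (t j) = 0 \<and> (-1) ^ (j div 2) * poly g (t j) < 0"
    using il unfolding interlaced_def by (metis (full_types))
  have g0: "g \<noteq> 0" and deg': "degree g \<le> n - 1" and m: "1 \<le> n - 1"
    using lead n deg by auto
  have sym: "poly g (- x) = 0" if "poly g x = 0" for x
    using gpar[of x] that by simp
  have zero: "\<And>k. k < n - 1 \<Longrightarrow> even k \<Longrightarrow> poly g (t k) = 0"
    using even_t by blast
  note gap = same_sign_in_gap[OF g0 sym m dec end0 zero deg']
  have beyond: "0 < poly g y" if "t 0 < y" for y
    using lead_sign_beyond[OF g0 sym m dec end0 zero deg' that] lead(2)
    by (simp add: zero_less_mult_iff)
  have fval: "poly f x = - poly h x" if "poly g x = 0" for x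
    using that by (simp add: h)
  have "\<exists>y. (if odd j then y = t (j - 1)
        else poly f y = 0 \<and> (if j = 0 then t 0 < y else
          (if j = n - 1 then y = 0 else t j < y \<and> y < t (j - 2)) \<and>
          0 < poly g y * poly g (t (j - 1))))" if j: "j < n" for j
  proof (cases "odd j")
    case False
    show ?thesis
    proof (cases "j = 0")
      case True
      have "poly f (t 0) < 0"
        using even_t[of 0] m by (simp add: fval)
      moreover obtain b where b: "\<And>x. b \<le> x \<Longrightarrow> lead_coeff f \<le> poly f x"
        using poly_pinfty_gt_lc[OF lead(1)] by blast
      have "0 < poly f (max b (t 0 + 1))"
        using b[of "max b (t 0 + 1)"] lead(1) by simp
      moreover have "t 0 < max b (t 0 + 1)" by simp
      ultimately show ?thesis
        using poly_IVT_pos[of "t 0" "max b (t 0 + 1)" f] True by auto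
    next
      case j0: False
      then obtain k where k: "j = Suc (Suc k)" "even k"
        using False by (metis even_Suc not0_implies_Suc odd_Suc_minus_one)
      have "Suc k < n - 1" using k j by simp
      then have "poly g (t (Suc k)) \<noteq> 0"
        using odd_t[of "Suc k"] k by auto
      then have gg: "0 < poly g (t (Suc k)) * poly g (t (Suc k))"
        by (auto simp: zero_less_mult_iff)
      show ?thesis
      proof (cases "j = n - 1")
        case True
        then have "n = Suc j" using n by linarith
        then have "odd n" using False by simp
        then have "poly f 0 = 0" using fpar[of 0] by simp
        moreover have "n = Suc (Suc (Suc k))" using True k n by linarith
        then have "t (Suc k) = 0" using end0 by simp
        ultimately show ?thesis
          using True False gg k end0 by auto
      next
        case neq: False
        then have k2: "Suc (Suc k) < n - 1" using j k by simp
        have "poly f (t (Suc (Suc k))) * poly f (t k) = poly h (t (Suc (Suc k))) * poly h (t k)"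
          using zero[of k] zero[of "Suc (Suc k)"] k k2 by (simp add: fval)
        also have "\<dots> < 0"
          using even_t[of k] even_t[of "Suc (Suc k)"] k k2 minus_one_power_cases[of "k div 2"]
          by (auto simp: mult_less_0_iff)
        finally obtain y where y: "t (Suc (Suc k)) < y" "y < t k" "poly f y = 0"
          using poly_IVT[of "t (Suc (Suc k))" "t k" f] dec[of k] dec[of "Suc k"] k2 by auto
        have "0 < poly g y * poly g (t (Suc k))"
          using gap[of "Suc k" y] y k k2 by simp
        then show ?thesis using y False neq k by auto
      qed
    qed
  qed auto
  then obtain s where s: "\<And>j. j < n \<Longrightarrow> (if odd j then s j = t (j - 1)
        else poly f (s j) = 0 \<and> (if j = 0 then t 0 < s j else
          (if j = n - 1 then s j = 0 else t j < s j \<and> s j < t (j - 2)) \<and>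
          0 < poly g (s j) * poly g (t (j - 1))))"
    by metis
  show ?thesis
    unfolding interlaced_def
  proof (intro exI[of _ s] conjI allI impI)
    fix j assume j: "Suc j < n"
    show "s (Suc j) < s j"
    proof (cases "even j")
      case True
      then show ?thesis
        using s[of j] s[of "Suc j"] j by (auto split: if_splits)
    next
      case False
      then obtain k where k: "j = Suc k" "even k" by (cases j) auto
      have "t (Suc k) = 0" if "Suc j = n - 1"
      proof -
        have "n = Suc (Suc (Suc k))" using that k n by linarith
        then show ?thesis using end0 by simp
      qed
      then show ?thesis
        using k s[of j] s[of "Suc j"] j dec[of k] by (cases "Suc j = n - 1") auto
    qed
  next
    show "s (n - 1) = 0"
      using s[of "n - 1"] n end0 by (auto split: if_splits)
  next
    fix j assume j: "j < n"
    show "if even j then poly f (s j) = 0 \<and> 0 < (- 1) ^ (j div 2) * poly g (s j)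
         else poly g (s j) = 0 \<and> (- 1) ^ (j div 2) * poly f (s j) < 0"
    proof (cases "even j")
      case True
      show ?thesis
      proof (cases "j = 0")
        case True
        then show ?thesis using s[of j] beyond j by auto
      next
        case False
        then obtain k where k: "j = Suc (Suc k)" "even k"
          using True by (metis even_Suc not0_implies_Suc odd_Suc_minus_one)
        then have "Suc k < n - 1" using j by simp
        then show ?thesis
          using k s[of j] odd_t[OF \<open>Suc k < n - 1\<close>] j minus_one_power_cases[of "k div 2"]
          by (auto simp: zero_less_mult_iff)
      qed
    next
      case False
      then obtain k where k: "j = Suc k" "even k" by (cases j) auto
      then show ?thesis
        using s[of j] even_t[of k] j by (auto simp: fval)
    qed
  qed
qed

section \<open>Self-interlacing polynomials and interlaced pairs\<close>

text \<open>
  The absolute values of the roots, counted from the largest; the signs of the roots alternate in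
  such a way that the smallest one, \<open>j = n - 1\<close>, is positive.
\<close>

definition alternating_roots :: "real poly \<Rightarrow> (nat \<Rightarrow> real) \<Rightarrow> bool" where
  "alternating_roots p r \<longleftrightarrow>
     (\<forall>j. Suc j < degree p \<longrightarrow> r (Suc j) < r j) \<and>
     (\<forall>j<degree p. 0 < r j \<and> poly p (- ((-1) ^ degree p * (-1) ^ j * r j)) = 0)"

lemma alternating_rootsD:
  assumes "alternating_roots p r"
  shows "i < j \<Longrightarrow> j < degree p \<Longrightarrow> r j < r i"
    and "j < degree p \<Longrightarrow> 0 < r j"
    and "j < degree p \<Longrightarrow> poly p (- ((-1) ^ degree p * (-1) ^ j * r j)) = 0"
  using assms decreasing_from_Suc[of "degree p" r i j] by (auto simp: alternating_roots_def)

lemma alternating_sign: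
  assumes "i < n"
  shows "- ((-1) ^ n * (-1) ^ i) = ((-1) ^ (n - Suc i) :: real)"
proof -
  define m where "m = n - Suc i"
  have "n = i + Suc m" using assms by (simp add: m_def)
  then have "- ((-1) ^ n * (-1) ^ i) = ((-1) ^ i * (-1) ^ i * (-1) ^ m :: real)"
    by (simp add: power_add algebra_simps)
  then show ?thesis
    by (simp add: m_def flip: power_mult_distrib)
qed

lemma alternating_roots_inj:
  assumes "alternating_roots p r"
  shows "inj_on (\<lambda>i. - ((-1) ^ degree p * (-1) ^ i * r i)) {..<degree p}"
proof (rule inj_onI)
  fix i j assume ij: "i \<in> {..<degree p}" "j \<in> {..<degree p}"
    and eq: "- ((-1) ^ degree p * (-1) ^ i * r i) = - ((-1) ^ degree p * (-1) ^ j * r j)"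
  have "\<bar>r i\<bar> = \<bar>r j\<bar>"
    using arg_cong[OF eq, of abs] by (simp add: abs_mult power_abs)
  then have "r i = r j"
    using alternating_rootsD(2)[OF assms, of i] alternating_rootsD(2)[OF assms, of j] ij by simp
  then show "i = j"
    using alternating_rootsD(1)[OF assms, of i j] alternating_rootsD(1)[OF assms, of j i] ij
    by (cases i j rule: linorder_cases) auto
qed

text \<open>
  As many distinct real roots as the degree exhaust the sum of all complex orders.
\<close>

lemma simple_real_roots:
  fixes p :: "real poly"
  assumes p: "p \<noteq> 0" and A: "A \<subseteq> {x. poly p x = 0}" "card A = degree p" "finite A"
  shows "A = {x. poly p x = 0}"
    and "poly (map_poly complex_of_real p) z = 0 \<Longrightarrow>
      z \<in> \<real> \<and> Polynomial.order z (map_poly complex_of_real p) = 1"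
proof -
  show "A = {x. poly p x = 0}"
    using p A card_poly_roots_bound[OF p] by (intro card_seteq poly_roots_finite) auto
  define P where "P = map_poly complex_of_real p"
  let ?R = "{z. poly P z = 0}"
  have P: "P \<noteq> 0" "degree P = degree p"
    using p by (auto simp: P_def map_poly_eq_0_iff degree_map_poly)
  have eval: "poly P (complex_of_real x) = complex_of_real (poly p x)" for x
    by (simp add: P_def poly_altdef degree_map_poly coeff_map_poly)
  have fin: "finite ?R"
    by (rule poly_roots_finite[OF P(1)])
  have "card (complex_of_real ` A) = degree P"
    using A P by (simp add: card_image inj_on_def)
  moreover have sub: "complex_of_real ` A \<subseteq> ?R"
    using A(1) by (auto simp: eval)
  ultimately have R: "complex_of_real ` A = ?R" and card: "card ?R = degree P"
    using card_poly_roots_bound[OF P(1)] card_mono[OF fin sub]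
    by (auto intro!: card_seteq[OF fin])
  assume z: "poly (map_poly complex_of_real p) z = 0"
  then have z: "z \<in> ?R" by (simp add: P_def)
  have pos: "1 \<le> Polynomial.order x P" if "x \<in> ?R" for x
    using that order_root[of P x] P(1) by (simp add: Suc_le_eq)
  have "Polynomial.order z P = 1"
  proof (rule ccontr)
    assume "Polynomial.order z P \<noteq> 1"
    then have "1 < Polynomial.order z P"
      using pos[OF z] by simp
    then have "(\<Sum>x\<in>?R. 1) < (\<Sum>x\<in>?R. Polynomial.order x P)"
      using pos z by (intro sum_strict_mono_ex1[OF fin]) auto
    then show False
      using sum_order_le_degree[OF P(1)] card by simp
  qed
  then show "z \<in> \<real> \<and> Polynomial.order z (map_poly complex_of_real p) = 1"
    unfolding P_def using z unfolding R[symmetric] by auto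
qed

lemma self_interlacing_I_iff_alternating_roots:
  assumes n: "1 \<le> degree p"
  shows "self_interlacing_I p \<longleftrightarrow> (\<exists>r. alternating_roots p r)"
proof
  assume "self_interlacing_I p"
  then obtain l :: "nat \<Rightarrow> real" where bij: "bij_betw l {1..degree p} {x. poly p x = 0}"
    and l1: "0 < l 1"
    and chain: "\<And>i. i \<in> {1..<degree p} \<Longrightarrow> (-1) ^ (i - 1) * l i < (-1) ^ i * l (i + 1)"
    unfolding self_interlacing_I_def by blast
  define r where "r j = (-1) ^ (degree p - Suc j) * l (degree p - j)" for j
  have dec: "r (Suc j) < r j" if "Suc j < degree p" for j
  proof -
    have "degree p - Suc j + 1 = degree p - j"
      using that by simp
    then show ?thesis
      using chain[of "degree p - Suc j"] that by (simp add: r_def)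
  qed
  have "0 < r j" if "j < degree p" for j
  proof -
    have "r (degree p - 1) \<le> r j"
      using decreasing_from_Suc_le[of "degree p" r j "degree p - 1", OF dec] that by simp
    moreover have "r (degree p - 1) = l 1"
      using n by (simp add: r_def)
    ultimately show ?thesis using l1 by simp
  qed
  moreover have "poly p (- ((-1) ^ degree p * (-1) ^ j * r j)) = 0" if j: "j < degree p" for j
  proof -
    have "- ((-1) ^ degree p * (-1) ^ j * r j) = (-1) ^ (degree p - Suc j) * r j"
      unfolding minus_mult_left[of _ "r j"] alternating_sign[OF j] ..
    also have "\<dots> = (-1) ^ (degree p - Suc j) * (-1) ^ (degree p - Suc j) * l (degree p - j)"
      by (simp add: r_def)
    also have "\<dots> = l (degree p - j)"
      by (simp flip: power_mult_distrib)
    finally show ?thesis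
      using bij_betwE[OF bij] j by auto
  qed
  ultimately show "\<exists>r. alternating_roots p r"
    using dec by (auto simp: alternating_roots_def)
next
  assume "\<exists>r. alternating_roots p r"
  then obtain r where r: "alternating_roots p r" by blast
  let ?z = "\<lambda>i. - ((-1) ^ degree p * (-1) ^ i * r i)"
  \<comment> \<open>The numbering of the roots starts from the smallest absolute value.\<close>
  define l where "l i = ?z (degree p - i)" for i
  have p: "p \<noteq> 0" using n by auto
  have "?z ` {..<degree p} \<subseteq> {x. poly p x = 0}"
    using alternating_rootsD(3)[OF r] by auto
  moreover have "card (?z ` {..<degree p}) = degree p"
    using card_image[OF alternating_roots_inj[OF r]] by simp
  ultimately have roots: "?z ` {..<degree p} = {x. poly p x = 0}"
    and simple: "\<And>z. poly (map_poly complex_of_real p) z = 0 \<Longrightarrow>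
      z \<in> \<real> \<and> Polynomial.order z (map_poly complex_of_real p) = 1"
    using simple_real_roots[OF p] by auto
  have "bij_betw (\<lambda>i. degree p - i) {1..degree p} {..<degree p}"
    by (rule bij_betwI[of _ _ _ "\<lambda>i. degree p - i"]) auto
  moreover have "bij_betw ?z {..<degree p} {x. poly p x = 0}"
    using alternating_roots_inj[OF r] roots by (simp add: bij_betw_def)
  ultimately have bij: "bij_betw l {1..degree p} {x. poly p x = 0}"
    unfolding l_def using bij_betw_trans[of _ _ _ ?z] by (simp add: comp_def)
  have l: "l i = (-1) ^ (i - 1) * r (degree p - i)" if "1 \<le> i" "i \<le> degree p" for i
  proof -
    have "degree p - i < degree p" "degree p - Suc (degree p - i) = i - 1"
      using that by auto
    then show ?thesis
      using alternating_sign[of "degree p - i" "degree p"] unfolding l_def minus_mult_left by simp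
  qed
  have "0 < l 1"
    using l[of 1] n alternating_rootsD(2)[OF r, of "degree p - 1"] by simp
  moreover have "(-1) ^ (i - 1) * l i < (-1) ^ i * l (i + 1)" if "i \<in> {1..<degree p}" for i
  proof -
    have "r (degree p - i) < r (degree p - Suc i)"
      using alternating_rootsD(1)[OF r, of "degree p - Suc i" "degree p - i"] that by auto
    moreover have "(-1) ^ (i - 1) * l i = r (degree p - i)"
      "(-1) ^ i * l (i + 1) = r (degree p - Suc i)"
      using that by (simp_all add: l mult.assoc[symmetric] flip: power_mult_distrib)
    ultimately show ?thesis by simp
  qed
  ultimately show "self_interlacing_I p"
    unfolding self_interlacing_I_def using simple bij by blast
qed

text \<open>
  For \<open>e = 1\<close> and \<open>e = -1\<close> the left-hand side is \<open>p(y)\<close> or \<open>p(-y)\<close>, up to sign. In terms of the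
  two parts, the factorization of \<open>p\<close> has the same form for even and odd degree.
\<close>

lemma alternating_roots_product:
  fixes e :: real
  assumes r: "alternating_roots p r" and e: "e = 1 \<or> e = -1"
  shows "poly (main_part p) y + e * poly (lower_part p) y =
    lead_coeff p * (\<Prod>i<degree p. y + e * (-1) ^ i * r i)"
proof -
  let ?n = "degree p"
  let ?z = "\<lambda>i. - ((-1) ^ degree p * (-1) ^ i * r i)"
  define q where "q = smult (lead_coeff p) (\<Prod>i<?n. [:- ?z i, 1:])"
  have degq: "degree (\<Prod>i<?n. [:- ?z i, 1:]) = ?n"
    by (subst degree_prod_eq_sum_degree) auto
  have lcq: "lead_coeff (\<Prod>i<?n. [:- ?z i, 1:]) = 1"
    by (subst lead_coeff_prod) auto
  have "p = q"
  proof (rule poly_eqI_degree_lead_coeff[where n = ?n and A = "?z ` {..<?n}"])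
    show "Polynomial.coeff p ?n = Polynomial.coeff q ?n"
      using lcq unfolding degq by (simp add: q_def)
    show "?n \<le> card (?z ` {..<?n})"
      using card_image[OF alternating_roots_inj[OF r]] by simp
    show "degree q \<le> ?n"
      using degree_smult_le[of "lead_coeff p" "\<Prod>i<?n. [:- ?z i, 1:]"] degq by (simp add: q_def)
    fix z assume "z \<in> ?z ` {..<?n}"
    then obtain i where i: "i < ?n" "z = ?z i" by blast
    then have "poly q z = 0"
      unfolding q_def by (auto simp: poly_prod intro!: bexI[of _ i])
    then show "poly p z = poly q z"
      using alternating_rootsD(3)[OF r i(1)] i by simp
  qed simp
  then have p: "poly p x = lead_coeff p * (\<Prod>i<?n. x + (-1) ^ ?n * (-1) ^ i * r i)" for x
    by (metis (no_types, lifting) q_def poly_smult poly_prod poly_pCons poly_0 mult_zero_right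
        add_0_right mult_1_right add.commute minus_minus prod.cong)
  have neg: "(\<Prod>i<?n. - x i) = (-1) ^ ?n * (\<Prod>i<?n. x i)" for x :: "nat \<Rightarrow> real"
    by (simp add: prod_uminus)
  show ?thesis
  proof (cases "even ?n")
    case True
    then show ?thesis
      using e neg[of "\<lambda>i. y - (-1) ^ i * r i"]
      by (auto simp: poly_main_part poly_lower_part p field_simps)
  next
    case False
    then show ?thesis
      using e neg[of "\<lambda>i. y + (-1) ^ i * r i"]
      by (auto simp: poly_main_part poly_lower_part p field_simps)
  qed
qed

text \<open>
  The exponents add up to \<open>j (j - 1) / 2\<close>, which has the parity of \<open>j div 2\<close>.
\<close>

lemma prod_minus_one_power: "(\<Prod>i<j. (-1) ^ i) = ((-1) ^ (j div 2) :: real)"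
proof (induction j)
  case (Suc j)
  then show ?case by (cases "even j") (auto simp: minus_one_power_iff elim!: evenE oddE)
qed simp

text \<open>
  In the product formula the first \<open>j\<close> factors have the sign of \<open>e * (-1) ^ i\<close>, and the others
  are positive.
\<close>

lemma sign_at_knot:
  fixes e :: real
  assumes r: "alternating_roots p r" and e: "e = 1 \<or> e = -1" and lead: "0 < lead_coeff p"
    and j: "j \<le> degree p" and y: "0 \<le> y"
    and below: "\<And>i. i < j \<Longrightarrow> y < r i"
    and above: "\<And>i. j \<le> i \<Longrightarrow> i < degree p \<Longrightarrow> 0 < y + e * (-1) ^ i * r i"
  shows "0 < e ^ j * (-1) ^ (j div 2) * (poly (main_part p) y + e * poly (lower_part p) y)"
proof -
  have split: "{..<degree p} = {..<j} \<union> {j..<degree p}" using j by auto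
  have "e ^ j * (-1) ^ (j div 2) * (\<Prod>i<degree p. y + e * (-1) ^ i * r i) =
      (\<Prod>i<j. e * (-1) ^ i * (y + e * (-1) ^ i * r i)) * (\<Prod>i=j..<degree p. y + e * (-1) ^ i * r i)"
    unfolding split by (subst prod.union_disjoint) (auto simp: prod.distrib prod_minus_one_power)
  moreover have "0 < e * (-1) ^ i * (y + e * (-1) ^ i * r i)" if "i < j" for i
    using below[OF that] y e minus_one_power_cases[of i] by auto
  then have "0 < (\<Prod>i<j. e * (-1) ^ i * (y + e * (-1) ^ i * r i))"
    by (intro prod_pos) auto
  moreover have "0 < (\<Prod>i=j..<degree p. y + e * (-1) ^ i * r i)"
    using above by (intro prod_pos) auto
  ultimately have "0 < e ^ j * (-1) ^ (j div 2) * (\<Prod>i<degree p. y + e * (-1) ^ i * r i)"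
    by simp
  then have "0 < lead_coeff p * (e ^ j * (-1) ^ (j div 2) * (\<Prod>i<degree p. y + e * (-1) ^ i * r i))"
    using lead by simp
  then show ?thesis
    by (simp add: alternating_roots_product[OF r e] mult_ac)
qed

text \<open>
  At \<open>r j\<close> one of \<open>f - g\<close>, \<open>f + g\<close> vanishes and the other has a sign known from the product
  formula; this determines the signs of \<open>f\<close> and \<open>g\<close>. Between \<open>r (Suc j)\<close> and \<open>r j\<close> then \<open>f\<close>
  changes sign if \<open>j\<close> is even, and \<open>g\<close> if \<open>j\<close> is odd. At the zero found there, the other part
  coincides with \<open>f + g\<close>, so the product formula also gives its sign.
\<close>

lemma alternating_roots_imp_interlaced:
  assumes n: "1 \<le> degree p" and lead: "0 < lead_coeff p" and r: "alternating_roots p r"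
  shows "interlaced (degree p) (main_part p) (lower_part p)"
proof -
  let ?n = "degree p" and ?f = "poly (main_part p)" and ?g = "poly (lower_part p)"
  note dec = alternating_rootsD(1)[OF r] and pos = alternating_rootsD(2)[OF r]
  have at_r: "?f (r j) = (-1) ^ j * ?g (r j) \<and> 0 < (-1) ^ (j div 2) * ?g (r j)" if j: "j < ?n" for j
  proof -
    have "(\<Prod>i<?n. r j + - ((-1) ^ j) * (-1) ^ i * r i) = 0"
      using j by (auto intro!: bexI[of _ j] simp flip: power_mult_distrib)
    moreover have "?f (r j) + - ((-1) ^ j) * ?g (r j) =
        lead_coeff p * (\<Prod>i<?n. r j + - ((-1) ^ j) * (-1) ^ i * r i)"
      using minus_one_power_cases[of j] by (intro alternating_roots_product[OF r]) auto
    ultimately have "?f (r j) + - ((-1) ^ j) * ?g (r j) = 0"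
      by (simp only: mult_zero_right)
    then have eq: "?f (r j) = (-1) ^ j * ?g (r j)"
      by simp
    have "0 < r j + (-1) ^ j * (-1) ^ i * r i" if "j \<le> i" "i < ?n" for i
    proof (cases "i = j")
      case True
      then show ?thesis using pos[OF j] by (simp flip: power_mult_distrib)
    next
      case False
      then have "r i < r j" "0 < r i" using dec[of j i] pos[of i] that by auto
      then show ?thesis
        using minus_one_power_cases[of i] minus_one_power_cases[of j] by auto
    qed
    then have "0 < ((-1) ^ j) ^ j * (-1) ^ (j div 2) * (?f (r j) + (-1) ^ j * ?g (r j))"
      using j dec pos[OF j] minus_one_power_cases[of j] by (intro sign_at_knot[OF r _ lead]) auto
    then show ?thesis
      using eq by (cases "even j") (auto simp: mult.commute)
  qed
  have "\<exists>t. (if Suc j = ?n then t = 0 else r (Suc j) < t \<and> t < r j) \<and>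
      (if even j then ?f t = 0 else ?g t = 0)" if j: "j < ?n" for j
  proof (cases "Suc j = ?n")
    case True
    have "?f 0 = 0" if "even j"
      using True that by (simp add: poly_main_part flip: True)
    moreover have "?g 0 = 0" if "odd j"
      using True that by (simp add: poly_lower_part flip: True)
    ultimately show ?thesis using True by auto
  next
    case False
    then have j': "Suc j < ?n" using j by simp
    show ?thesis
    proof (cases "even j")
      case True
      have "?f (r (Suc j)) * ?f (r j) < 0"
        using at_r[OF j] at_r[OF j'] True minus_one_power_cases[of "j div 2"]
        by (auto simp: mult_less_0_iff zero_less_mult_iff)
      then show ?thesis
        using poly_IVT[OF dec[OF _ j'], of j] True False by auto
    next
      case odd: False
      have "?g (r (Suc j)) * ?g (r j) < 0"
        using at_r[OF j] at_r[OF j'] odd minus_one_power_cases[of "j div 2"]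
        by (auto simp: mult_less_0_iff zero_less_mult_iff)
      then show ?thesis
        using poly_IVT[OF dec[OF _ j'], of j] odd False by auto
    qed
  qed
  then obtain s where s: "\<And>j. j < ?n \<Longrightarrow>
      (if Suc j = ?n then s j = 0 else r (Suc j) < s j \<and> s j < r j) \<and>
      (if even j then ?f (s j) = 0 else ?g (s j) = 0)"
    by metis
  show ?thesis
    unfolding interlaced_def
  proof (intro exI[of _ s] conjI allI impI)
    fix j assume j: "Suc j < ?n"
    then show "s (Suc j) < s j"
      using s[of j] s[of "Suc j"] pos[of "Suc j"] by (auto split: if_splits)
  next
    show "s (?n - 1) = 0"
      using s[of "?n - 1"] n by simp
  next
    fix j assume j: "j < ?n"
    have s_lt: "s j < r i" if "i < Suc j" for i
    proof -
      have "s j < r j" using s[OF j] pos[OF j] by (auto split: if_splits)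
      moreover have "r j \<le> r i" using dec[of i j] that j by (cases "i = j") auto
      ultimately show ?thesis by simp
    qed
    have s_gt: "r i < s j" if "Suc j \<le> i" "i < ?n" for i
    proof -
      have "r (Suc j) < s j" using s[OF j] that by auto
      moreover have "r i \<le> r (Suc j)" using dec[of "Suc j" i] that by (cases "i = Suc j") auto
      ultimately show ?thesis by simp
    qed
    have "0 \<le> s j"
      using s[OF j] pos[of "Suc j"] j by (auto split: if_splits)
    moreover have "0 < s j + 1 * (-1) ^ i * r i" if "Suc j \<le> i" "i < ?n" for i
      using s_gt[OF that] pos[OF that(2)] minus_one_power_cases[of i] by auto
    ultimately have "0 < 1 ^ Suc j * (-1) ^ (Suc j div 2) * (?f (s j) + 1 * ?g (s j))"
      using j s_lt by (intro sign_at_knot[OF r _ lead]) auto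
    then show "if even j then ?f (s j) = 0 \<and> 0 < (-1) ^ (j div 2) * ?g (s j)
        else ?g (s j) = 0 \<and> (-1) ^ (j div 2) * ?f (s j) < 0"
      using s[OF j] by auto
  qed
qed

lemma poly_main_plus_lower:
  "poly p x = poly (main_part p) x + (-1) ^ degree p * poly (lower_part p) x"
  "poly p (- x) = (-1) ^ degree p * (poly (main_part p) x - (-1) ^ degree p * poly (lower_part p) x)"
  using minus_one_power_cases[of "degree p"]
  by (auto simp: poly_main_part poly_lower_part field_simps)

lemma degree_lower_part: "degree (lower_part p) \<le> degree p - 1"
proof (rule degree_le, intro allI impI)
  fix k assume "degree p - 1 < k"
  then have "k = degree p \<or> degree p < k" by linarith
  then show "Polynomial.coeff (lower_part p) k = 0"
    by (auto simp: coeff_lower_part coeff_eq_0)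
qed

lemma lead_main_part:
  "degree (main_part p) = degree p" "lead_coeff (main_part p) = lead_coeff p"
proof -
  have "degree (main_part p) \<le> degree p"
    by (rule degree_le) (simp add: coeff_main_part coeff_eq_0)
  moreover have "Polynomial.coeff (main_part p) (degree p) = lead_coeff p"
    by (simp add: coeff_main_part)
  ultimately show "degree (main_part p) = degree p"
    by (metis leading_coeff_0_iff le_antisym le_degree degree_0 le0)
  then show "lead_coeff (main_part p) = lead_coeff p"
    by (simp add: coeff_main_part)
qed

text \<open>
  The function \<open>f - (-1) ^ j * g\<close> changes sign between consecutive knots \<open>s j\<close> and \<open>s (j - 1)\<close>,
  since at each of them one of the two terms vanishes. For \<open>j = 0\<close> the upper end is infinity,
  where \<open>f\<close> dominates.
\<close>

lemma interlaced_imp_alternating_roots: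
  assumes n: "1 \<le> degree p" and lead: "0 < lead_coeff p"
    and il: "interlaced (degree p) (main_part p) (lower_part p)"
  shows "\<exists>r. alternating_roots p r"
proof -
  let ?n = "degree p" and ?f = "poly (main_part p)" and ?g = "poly (lower_part p)"
  obtain s :: "nat \<Rightarrow> real" where dec: "\<And>j. Suc j < ?n \<Longrightarrow> s (Suc j) < s j"
    and end0: "s (?n - 1) = 0"
    and even_s: "\<And>j. j < ?n \<Longrightarrow> even j \<Longrightarrow> ?f (s j) = 0 \<and> 0 < (-1) ^ (j div 2) * ?g (s j)"
    and odd_s: "\<And>j. j < ?n \<Longrightarrow> odd j \<Longrightarrow> ?g (s j) = 0 \<and> (-1) ^ (j div 2) * ?f (s j) < 0"
    using il unfolding interlaced_def by (metis (full_types))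
  have nonneg: "0 \<le> s j" if "j < ?n" for j
    using decreasing_from_Suc_le[of ?n s j "?n - 1", OF dec] end0 that n by simp
  have "\<exists>y. s j < y \<and> (0 < j \<longrightarrow> y < s (j - 1)) \<and> ?f y = (-1) ^ j * ?g y" if j: "j < ?n" for j
  proof (cases j)
    case 0
    define F where "F = main_part p - lower_part p"
    have "degree (lower_part p) < degree (main_part p)"
      using degree_lower_part[of p] n lead_main_part(1)[of p] by simp
    then have "lead_coeff F = lead_coeff p"
      using lead_coeff_add_le[of "- lower_part p" "main_part p"] lead_main_part(2)[of p]
      by (simp add: F_def)
    then obtain b where b: "\<And>x. b \<le> x \<Longrightarrow> lead_coeff p \<le> poly F x"
      using poly_pinfty_gt_lc[of F] lead by auto
    have "0 < poly F (max b (s 0 + 1))"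
      using b[of "max b (s 0 + 1)"] lead by simp
    moreover have "poly F (s 0) < 0"
      using even_s[of 0] n by (simp add: F_def)
    moreover have "s 0 < max b (s 0 + 1)" by simp
    ultimately obtain y where "s 0 < y" "poly F y = 0"
      using poly_IVT_pos[of "s 0" "max b (s 0 + 1)" F] by blast
    then show ?thesis using 0 by (auto simp: F_def)
  next
    case (Suc k)
    define F where "F = main_part p - smult ((-1) ^ j) (lower_part p)"
    have "poly F (s j) * poly F (s k) < 0"
    proof (cases "even j")
      case True
      then show ?thesis
        using even_s[of j] odd_s[of k] j Suc minus_one_power_cases[of "k div 2"]
        by (auto simp: F_def mult_less_0_iff zero_less_mult_iff)
    next
      case False
      then show ?thesis
        using odd_s[of j] even_s[of k] j Suc minus_one_power_cases[of "k div 2"]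
        by (auto simp: F_def mult_less_0_iff zero_less_mult_iff)
    qed
    then obtain y where "s j < y" "y < s k" "poly F y = 0"
      using poly_IVT[of "s j" "s k" F] dec[of k] j Suc by auto
    then show ?thesis using Suc by (auto simp: F_def)
  qed
  then obtain r where r: "\<And>j. j < ?n \<Longrightarrow>
      s j < r j \<and> (0 < j \<longrightarrow> r j < s (j - 1)) \<and> ?f (r j) = (-1) ^ j * ?g (r j)"
    by metis
  have "r (Suc j) < r j" if "Suc j < ?n" for j
    using r[of j] r[of "Suc j"] that by simp
  moreover have "0 < r j" if "j < ?n" for j
    using r[OF that] nonneg[OF that] by simp
  moreover have "poly p (- ((-1) ^ ?n * (-1) ^ j * r j)) = 0" if "j < ?n" for j
    using r[OF that] minus_one_power_cases[of j] minus_one_power_cases[of ?n]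
      poly_main_plus_lower[of p "r j"] by auto
  ultimately show ?thesis
    by (auto simp: alternating_roots_def)
qed

lemma poly_parts_minus:
  "poly (main_part p) (- x) = (-1) ^ degree p * poly (main_part p) x"
  "poly (lower_part p) (- x) = - ((-1) ^ degree p) * poly (lower_part p) x"
  using minus_one_power_cases[of "degree p"]
  by (auto simp: poly_main_part poly_lower_part field_simps)

section \<open>Hurwitz determinants and interlaced pairs\<close>

lemma parts_routh_reduct:
  assumes n: "1 \<le> degree p" and a1: "lower_lc p \<noteq> 0"
  shows "main_part (routh_reduct p) = lower_part p"
    and "lower_part (routh_reduct p) = routh_remainder p"
proof -
  have deg: "degree (routh_reduct p) = degree p - 1"
    by (rule degree_routh_reduct(1)[OF n a1])
  have sgn: "(-1) ^ (degree p - 1) = - ((-1) ^ degree p :: real)"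
    using n by (cases "degree p") auto
  have red: "poly (routh_reduct p) y = poly (lower_part p) y - (-1) ^ degree p *
      (lead_coeff p / lower_lc p * y * poly (lower_part p) y - poly (main_part p) y)" for y
    by (simp add: routh_reduct_def routh_remainder_def)
  have "poly (main_part (routh_reduct p)) x = poly (lower_part p) x" for x
    using minus_one_power_cases[of "degree p"]
    by (auto simp: poly_main_part[of "routh_reduct p"] poly_lower_part[of "routh_reduct p"] deg
        sgn[simplified] red poly_parts_minus routh_remainder_def algebra_simps diff_divide_distrib)
  then show "main_part (routh_reduct p) = lower_part p"
    by (simp add: poly_eq_poly_eq_iff[symmetric] fun_eq_iff)
  have "poly (lower_part (routh_reduct p)) x = poly (routh_remainder p) x" for x
    using minus_one_power_cases[of "degree p"]
    by (auto simp: poly_main_part[of "routh_reduct p"] poly_lower_part[of "routh_reduct p"] deg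
        sgn[simplified] red poly_parts_minus routh_remainder_def algebra_simps diff_divide_distrib)
  then show "lower_part (routh_reduct p) = routh_remainder p"
    by (simp add: poly_eq_poly_eq_iff[symmetric] fun_eq_iff)
qed

text \<open>
  In degree one both sides say that \<open>lower_lc p\<close> is positive. In higher degree both are equivalent
  to positivity of \<open>lower_lc p\<close> together with the same condition on the Routh reduct.
\<close>

lemma hurwitz_signs_iff_interlaced:
  assumes "1 \<le> degree p" "0 < lead_coeff p"
  shows "hurwitz_signs p \<longleftrightarrow> interlaced (degree p) (main_part p) (lower_part p)"
  using assms
proof (induction "degree p" arbitrary: p)
  case (Suc m)
  let ?n = "degree p" and ?f = "main_part p" and ?g = "lower_part p" and ?h = "routh_remainder p"
  note n = \<open>1 \<le> degree p\<close> and lead = \<open>0 < lead_coeff p\<close>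
  have signs: "hurwitz_signs p \<longleftrightarrow> 0 < lower_lc p \<and> hurwitz_signs (routh_reduct p)"
    using hurwitz_signs_imp_lower_lc_pos[OF _ n] hurwitz_signs_routh_reduct[OF n] by blast
  show ?case
  proof (cases "m = 0")
    case True
    then have deg: "degree p = 1" using Suc by simp
    have "hurwitz_signs (routh_reduct p)" if "0 < lower_lc p"
      using degree_routh_reduct(1)[OF n] that deg by (simp add: hurwitz_signs_def)
    moreover have "poly ?f 0 = 0"
      by (simp add: poly_main_part deg)
    moreover have "poly ?g 0 = lower_lc p"
      by (simp add: deg lower_lc_def poly_0_coeff_0)
    ultimately show ?thesis
      using signs interlaced_1[of ?f ?g] by (auto simp: deg)
  next
    case False
    then have n2: "2 \<le> ?n" using Suc by simp
    have h: "poly ?h x = lead_coeff p / lower_lc p * x * poly ?g x - poly ?f x" for x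
      by (simp add: routh_remainder_def)
    have step: "interlaced ?n ?f ?g \<longleftrightarrow> interlaced (?n - 1) ?g ?h" if pos: "0 < lower_lc p"
    proof
      show "interlaced (?n - 1) ?g ?h" if "interlaced ?n ?f ?g"
        by (rule interlaced_step_forward(2)[OF n2 poly_parts_minus degree_lower_part h that])
      have degg: "degree ?g = ?n - 1"
        using pos degree_lower_part[of p] le_degree[of ?g "?n - 1"] by (simp add: lower_lc_def)
      show "interlaced ?n ?f ?g" if "interlaced (?n - 1) ?g ?h"
        using pos lead lead_main_part(2)[of p]
        by (intro interlaced_step_backward[OF n2 poly_parts_minus degg h _ _ that])
          (simp_all add: degg lower_lc_def)
    qed
    have "0 < lower_lc p" if "interlaced ?n ?f ?g"
      unfolding lower_lc_def
      by (rule interlaced_step_forward(1)[OF n2 poly_parts_minus degree_lower_part h that])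
    moreover have "hurwitz_signs (routh_reduct p) \<longleftrightarrow> interlaced (?n - 1) ?g ?h" if "0 < lower_lc p"
    proof -
      have a1: "lower_lc p \<noteq> 0" using that by simp
      show ?thesis
        using Suc(1)[of "routh_reduct p"] Suc(2) that n2 degree_routh_reduct[OF n a1]
        by (simp add: parts_routh_reduct[OF n a1])
    qed
    ultimately show ?thesis
      using signs step by blast
  qed
qed simp

lemma hurwitz_signs_iff_lists:
  assumes "degree p = n"
  shows "hurwitz_signs p \<longleftrightarrow>
    (\<forall>k. 2 * k + 1 < n \<longrightarrow> hurwitz_det p (n - 1 - 2 * k) > 0) \<and>
    (\<forall>k. 2 * k < n \<longrightarrow> (-1) ^ ((n + 1) div 2 - k) * hurwitz_det p (n - 2 * k) > 0)"
    (is "_ \<longleftrightarrow> ?odd \<and> ?even")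
proof
  assume signs: "hurwitz_signs p"
  have "0 < hurwitz_det p (n - 1 - 2 * k)" if "2 * k + 1 < n" for k
  proof -
    have "n - (n - 1 - 2 * k) = 2 * k + 1" using that by simp
    then show ?thesis
      using signs that assms unfolding hurwitz_signs_def
      by (auto simp: hurwitz_sign_def dest!: spec[of _ "n - 1 - 2 * k"])
  qed
  moreover have "0 < (-1) ^ ((n + 1) div 2 - k) * hurwitz_det p (n - 2 * k)" if "2 * k < n" for k
  proof -
    have "n - (n - 2 * k) = 2 * k" "(n - 2 * k + 1) div 2 = (n + 1) div 2 - k" using that by auto
    then show ?thesis
      using signs that assms unfolding hurwitz_signs_def
      by (auto simp: hurwitz_sign_def dest!: spec[of _ "n - 2 * k"])
  qed
  ultimately show "?odd \<and> ?even" by blast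
next
  assume lists: "?odd \<and> ?even"
  show "hurwitz_signs p"
    unfolding hurwitz_signs_def
  proof (intro allI impI)
    fix j assume "1 \<le> j \<and> j \<le> degree p"
    then have j: "1 \<le> j" "j \<le> n" using assms by auto
    define k where "k = (n - j) div 2"
    show "0 < hurwitz_sign (degree p) j * hurwitz_det p j"
    proof (cases "even (n - j)")
      case True
      then have "n - j = 2 * k" by (simp add: k_def)
      then have "j = n - 2 * k" "2 * k < n" "(j + 1) div 2 = (n + 1) div 2 - k" using j by auto
      then show ?thesis
        using lists True by (auto simp: hurwitz_sign_def assms)
    next
      case False
      then have "n - j = 2 * k + 1" unfolding k_def by (metis odd_two_times_div_two_succ)
      then have "j = n - 1 - 2 * k" "2 * k + 1 < n" using j by auto
      then show ?thesis
        using lists False by (auto simp: hurwitz_sign_def assms)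
    qed
  qed
qed

theorem theorem4p7:
  fixes p :: "real poly" and n :: nat
  assumes "degree p = n" and "n \<ge> 1" and "desc_coeff p 0 > 0"
  defines "cond1 \<equiv> self_interlacing_I p"
    and "cond2 \<equiv>
      (\<forall>k. 2 * k + 1 < n \<longrightarrow> hurwitz_det p (n - 1 - 2 * k) > 0) \<and>
      (\<forall>k. 2 * k < n \<longrightarrow> (-1) ^ ((n + 1) div 2 - k) * hurwitz_det p (n - 2 * k) > 0)"
    and "cond3 \<equiv>
      (\<forall>k. 2 * k < n \<longrightarrow> eta_minor p (n - 2 * k) > 0) \<and>
      eta_minor p 1 = desc_coeff p 0 \<and> desc_coeff p 0 > 0 \<and>
      (\<forall>k. 2 * k < n + 1 \<longrightarrow> (-1) ^ ((n + 1) div 2 - k) * eta_minor p (n + 1 - 2 * k) > 0)"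
  shows "(cond1 \<longleftrightarrow> cond2) \<and> (cond2 \<longleftrightarrow> cond3)"
proof
  have lead: "0 < lead_coeff p" and n: "1 \<le> degree p"
    using assms(1-3) by (simp_all add: desc_coeff_def)
  have "cond1 \<longleftrightarrow> interlaced (degree p) (main_part p) (lower_part p)"
    unfolding cond1_def self_interlacing_I_iff_alternating_roots[OF n]
    using alternating_roots_imp_interlaced[OF n lead] interlaced_imp_alternating_roots[OF n lead]
    by blast
  also have "\<dots> \<longleftrightarrow> cond2"
    unfolding cond2_def hurwitz_signs_iff_lists[OF assms(1), symmetric]
    by (rule hurwitz_signs_iff_interlaced[OF n lead, symmetric])
  finally show "cond1 \<longleftrightarrow> cond2" .
next
  let ?a = "desc_coeff p 0"
  have eta: "0 < c * eta_minor p (Suc j) \<longleftrightarrow> 0 < c * hurwitz_det p j" for c j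
    using assms(3) by (simp add: eta_minor_Suc zero_less_mult_iff mult_less_0_iff)
  have det0: "hurwitz_det p 0 = 1"
    by (simp add: hurwitz_det_def)
  have eta1: "eta_minor p 1 = ?a"
    using eta_minor_Suc[of p 0] det0 by simp
  \<comment> \<open>For odd \<open>n\<close> this list ends with \<open>\<eta>\<^sub>1\<close>, which corresponds to the empty determinant.\<close>
  have odd: "0 < eta_minor p (n - 2 * k) \<longleftrightarrow> (2 * k + 1 < n \<longrightarrow> 0 < hurwitz_det p (n - 1 - 2 * k))"
    if "2 * k < n" for k
  proof -
    have "n - 2 * k = Suc (n - 1 - 2 * k)" using that by simp
    moreover have "n - 1 - 2 * k = 0" if "\<not> 2 * k + 1 < n" using that by simp
    ultimately show ?thesis
      using eta[of 1 "n - 1 - 2 * k"] det0 by auto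
  qed
  \<comment> \<open>If \<open>n\<close> is even, the last entry of the list is \<open>\<eta>\<^sub>1 = a\<^sub>0\<close>, which has no counterpart among the
      Hurwitz determinants; its sign is \<open>+\<close>.\<close>
  have even: "0 < (-1) ^ ((n + 1) div 2 - k) * eta_minor p (n + 1 - 2 * k) \<longleftrightarrow>
      (2 * k < n \<longrightarrow> 0 < (-1) ^ ((n + 1) div 2 - k) * hurwitz_det p (n - 2 * k))"
    if "2 * k < n + 1" for k
  proof -
    have "n + 1 - 2 * k = Suc (n - 2 * k)" using that by simp
    moreover have "n - 2 * k = 0" "(n + 1) div 2 - k = 0" if "\<not> 2 * k < n"
      using that \<open>2 * k < n + 1\<close> by auto
    ultimately show ?thesis
      using eta[of "(-1) ^ ((n + 1) div 2 - k)" "n - 2 * k"] det0 by auto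
  qed
  show "cond2 \<longleftrightarrow> cond3"
    unfolding cond2_def cond3_def using odd even eta1 assms(3)
    by (metis (no_types, lifting) add_lessD1 less_SucI Suc_eq_plus1)
qed

end
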